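(* Let $d\ge1$, let $\mathcal X\subset\mathbb R^d$ be non-empty and compact, let $\|\cdot\|$ be a norm on $\mathbb R^d$, let $L>0$, and let $\varepsilon_0:=L\max_{x,y\in\mathcal X}\|x-y\|$. Let c.DOO be the algorithm described in the context, run with a hierarchy of cells and representatives satisfying conditions (D1) and (D2) of the context with constants $K$, $\delta$, $R$, $\nu$. Then c.DOO is a certified algorithm and, letting $$a_d:=2+K\left(\mathbf 1_{\nu/R\ge1}+\mathbf 1_{\nu/R<1}(4R/\nu)^d\right),$$ its sample complexity satisfies, for all $f\in\mathcal F_L$ and all $\varepsilon\in(0,\varepsilon_0]$, $$\sigma(\text{c.DOO},f,\varepsilon)\le a_d\,S_{\mathrm C}(f,\varepsilon).$$
   Context: For Lipschitz $f:\mathcal X\to\mathbb R$, $\mathrm{Lip}(f)$ is its smallest Lipschitz constant with respect to $\|\cdot\|$; $f$ is $L$-Lipschitz if $\mathrm{Lip}(f)\le L$; $\mathcal F_L:=\{g:\mathcal X\to\mathbb R\mid g\text{ Lipschitz and }\mathrm{Lip}(g)<L\}$. For $\varepsilon>0$, $\mathcal X_\varepsilon:=\{x\in\mathcal X:\max(f)-f(x)\le\varepsilon\}$, and for $0\le a<b$, $\mathcal X_{(a,b]}:=\{x\in\mathcal X:a<\max(f)-f(x)\le b\}$. For bounded $E\subset\mathbb R^d$ and $r>0$, the packing number is $\mathcal N(E,r):=\sup\{k\ge1:\exists x_1,\dots,x_k\in E,\ \min_{i\ne j}\|x_i-x_j\|>r\}$ if $E\neq\varnothing$, and $0$ if $E=\varnothing$.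 For $\varepsilon\in(0,\varepsilon_0]$ let $m_\varepsilon:=\lceil\log_2(\varepsilon_0/\varepsilon)\rceil$, $\varepsilon_{m_\varepsilon}:=\varepsilon$, $\varepsilon_k:=\varepsilon_02^{-k}$ for $0\le k\le m_\varepsilon-1$, and $$S_{\mathrm C}(f,\varepsilon):=\mathcal N\left(\mathcal X_\varepsilon,\frac{\varepsilon}{L}\right)+\sum_{k=1}^{m_\varepsilon}\mathcal N\left(\mathcal X_{(\varepsilon_k,\varepsilon_{k-1}]},\frac{\varepsilon_k}{L}\right).$$ Certified algorithm (for $\mathcal X$, $\|\cdot\|$, $L$): a deterministic sequential procedure that, run on a function $f:\mathcal X\to\mathbb R$, at each round $n\ge1$ chooses a query point $x_n\in\mathcal X$ as a function of $f(x_1),\dots,f(x_{n-1})$ only ($x_1$ is fixed), observes $f(x_n)$, and then outputs, as functions of $f(x_1),\dots,f(x_n)$ only, a recommendation $x_n^\star\in\mathcal X$ and an error certificate $\xi_n\ge0$, subject to the constraint that for every $L$-Lipschitz $f:\mathcal X\to\mathbb R$ and every $n\ge1$, $\max(f)-f(x_n^\star)\le\xi_n$. Its sample complexity is $\sigma(A,f,\varepsilon):=\inf\{n\ge1:\xi_n\le\varepsilon\}\in\{1,2,\dots\}\cup\{+\infty\}$, where $\xi_n$ are the certificates output when $A$ is run on $f$. Hierarchy of cells: fix $K\in\{1,2,\dots\}$ and subsets $X_{h,i}$ of $\mathbb R^d$ ($h\in\mathbb N=\{0,1,\dots\}$, $i=0,\dots,K^h-1$), called cells, such that for each $h$ the cells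 $X_{h,0},\dots,X_{h,K^h-1}$ are non-empty, pairwise disjoint, and their union contains $\mathcal X$; and for each $(h,j)$ there are $K$ distinct indices $i_1,\dots,i_K\in\{0,\dots,K^{h+1}-1\}$ such that $X_{h+1,i_1},\dots,X_{h+1,i_K}$ form a partition of $X_{h,j}$; $(h+1,i_1),\dots,(h+1,i_K)$ are called the children of $(h,j)$. Each cell has a representative $x_{h,i}\in X_{h,i}$, with $x_{h,i}\in\mathcal X$ whenever $X_{h,i}\cap\mathcal X\ne\varnothing$. Conditions: (D1) there are $\delta\in(0,1)$, $R>0$ with $\|u-v\|\le R\delta^h$ for all $h,i$ and all $u,v\in X_{h,i}$; (D2) there is $\nu>0$ with $\|x_{h,i}-x_{h',i'}\|\ge\nu\delta^{\max(h,h')}$ for all $(h,i)\ne(h',i')$. Algorithm c.DOO (certified DOO): set $n=1$ and $\mathcal L=\{(0,0)\}$; query $x_1=x_{0,0}$, recommend $x_1^\star=x_1$, output certificate $\xi_1=LR$. Then repeat for iterations $k=1,2,\dots$: choose $(h^\star,i^\star)\in\mathrm{argmax}_{(h,i)\in\mathcal L}\{f(x_{h,i})+LR\delta^h\}$ (ties broken by an arbitrary deterministic rule); for each child $(h^\star+1,j)$ of $(h^\star,i^\star)$ in turn with $X_{h^\star+1,j}\cap\mathcal X\ne\varnothing$: increase $n$ by one, add $(h^\star+1,j)$ to $\mathcal L$, query $x_n=x_{h^\star+1,j}$, output a recommendation $x_n^\star\in\mathrm{argmax}_{x\in\{x_1,\dots,x_n\}}f(x)$ and the certificate $\xi_n=f(x_{h^\star,i^\star})+LR\delta^{h^\star}-f(x_n^\star)$;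 after all children are processed, remove $(h^\star,i^\star)$ from $\mathcal L$.
   Formalization: Non-negativity of the certificates ξ_n is required only for runs on L-Lipschitz f, not on arbitrary f: for non-L-Lipschitz f a child's value can exceed f(x_{h*,i*})+LRδ^{h*}, making c.DOO's certificate negative, so the literal requirement fails. *)

theory Defs
  imports "HOL-Analysis.Analysis"
begin

section \<open>Norms and Lipschitz functions\<close>

text \<open>The norm is an arbitrary one, independent of the Euclidean norm of the type class.\<close>

definition is_norm :: "('a::real_vector \<Rightarrow> real) \<Rightarrow> bool" where
  "is_norm N \<longleftrightarrow>
     (\<forall>x. N x \<ge> 0) \<and> (\<forall>x. N x = 0 \<longleftrightarrow> x = 0) \<and>
     (\<forall>c x. N (c *\<^sub>R x) = \<bar>c\<bar> * N x) \<and> (\<forall>x y. N (x + y) \<le> N x + N y)"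

text \<open>Functions on \<open>X\<close> are total functions of which only the values on \<open>X\<close> matter.\<close>

definition lip_bounds :: "'a set \<Rightarrow> ('a::real_vector \<Rightarrow> real) \<Rightarrow> ('a \<Rightarrow> real) \<Rightarrow> real set" where
  "lip_bounds X N f = {C. C \<ge> 0 \<and> (\<forall>x\<in>X. \<forall>y\<in>X. \<bar>f x - f y\<bar> \<le> C * N (x - y))}"

definition lipschitz_fun :: "'a set \<Rightarrow> ('a::real_vector \<Rightarrow> real) \<Rightarrow> ('a \<Rightarrow> real) \<Rightarrow> bool" where
  "lipschitz_fun X N f \<longleftrightarrow> lip_bounds X N f \<noteq> {}"

definition Lip :: "'a set \<Rightarrow> ('a::real_vector \<Rightarrow> real) \<Rightarrow> ('a \<Rightarrow> real) \<Rightarrow> real" where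
  "Lip X N f = Inf (lip_bounds X N f)"

definition L_lipschitz :: "'a set \<Rightarrow> ('a::real_vector \<Rightarrow> real) \<Rightarrow> real \<Rightarrow> ('a \<Rightarrow> real) \<Rightarrow> bool" where
  "L_lipschitz X N L f \<longleftrightarrow> lipschitz_fun X N f \<and> Lip X N f \<le> L"

definition lip_class :: "'a set \<Rightarrow> ('a::real_vector \<Rightarrow> real) \<Rightarrow> real \<Rightarrow> ('a \<Rightarrow> real) set" where
  "lip_class X N L = {g. lipschitz_fun X N g \<and> Lip X N g < L}"

section \<open>Near-optimal sets, packing numbers and the quantity \<open>S\<^sub>C\<close>\<close>

text \<open>Used for Lipschitz \<open>f\<close> on a non-empty compact \<open>X\<close>, where the supremum is a maximum;
  likewise for \<open>eps0\<close>.\<close>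

definition max_on :: "'a set \<Rightarrow> ('a \<Rightarrow> real) \<Rightarrow> real" where
  "max_on X f = (SUP x\<in>X. f x)"

definition eps0 :: "'a set \<Rightarrow> ('a::real_vector \<Rightarrow> real) \<Rightarrow> real \<Rightarrow> real" where
  "eps0 X N L = L * (SUP (x, y)\<in>X \<times> X. N (x - y))"

definition near_opt :: "'a set \<Rightarrow> ('a \<Rightarrow> real) \<Rightarrow> real \<Rightarrow> 'a set" where
  "near_opt X f e = {x \<in> X. max_on X f - f x \<le> e}"

definition layer :: "'a set \<Rightarrow> ('a \<Rightarrow> real) \<Rightarrow> real \<Rightarrow> real \<Rightarrow> 'a set" where
  "layer X f a b = {x \<in> X. a < max_on X f - f x \<and> max_on X f - f x \<le> b}"

text \<open>For \<open>k = 1\<close> the separation condition is vacuous (the minimum over an empty set is infinite).\<close>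

definition packing_number :: "('a::real_vector \<Rightarrow> real) \<Rightarrow> 'a set \<Rightarrow> real \<Rightarrow> enat" where
  "packing_number N E r =
     (if E = {} then 0
      else Sup {enat k | k. k \<ge> 1 \<and>
             (\<exists>x :: nat \<Rightarrow> 'a. (\<forall>i<k. x i \<in> E) \<and>
                (\<forall>i<k. \<forall>j<k. i \<noteq> j \<longrightarrow> N (x i - x j) > r))})"

definition num_scales :: "real \<Rightarrow> real \<Rightarrow> nat" where
  "num_scales e0 e = nat \<lceil>log 2 (e0 / e)\<rceil>"

definition scale :: "real \<Rightarrow> real \<Rightarrow> nat \<Rightarrow> real" where
  "scale e0 e k = (if k = num_scales e0 e then e else e0 * (1/2) ^ k)"

definition S_C :: "'a set \<Rightarrow> ('a::real_vector \<Rightarrow> real) \<Rightarrow> real \<Rightarrow> ('a \<Rightarrow> real) \<Rightarrow> real \<Rightarrow> enat" where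
  "S_C X N L f e = (let e0 = eps0 X N L in
     packing_number N (near_opt X f e) (e / L) +
     (\<Sum>k = 1..num_scales e0 e.
        packing_number N (layer X f (scale e0 e k) (scale e0 e (k - 1))) (scale e0 e k / L)))"

section \<open>Certified algorithms\<close>

text \<open>A deterministic sequential procedure is given by three functions of the list
  \<open>[f x\<^sub>1, \<dots>, f x\<^sub>m]\<close> of past observations, oldest first. The \<open>n\<close>-th query is \<open>next_query\<close>
  of the first \<open>n - 1\<close> observations, while the \<open>n\<close>-th recommendation and certificate are
  functions of the first \<open>n\<close> observations.\<close>

record 'a algorithm =
  next_query :: "real list \<Rightarrow> 'a"
  recommend :: "real list \<Rightarrow> 'a"
  certificate :: "real list \<Rightarrow> real"

primrec observations :: "'a algorithm \<Rightarrow> ('a \<Rightarrow> real) \<Rightarrow> nat \<Rightarrow> real list" where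
  "observations A f 0 = []"
| "observations A f (Suc n) = observations A f n @ [f (next_query A (observations A f n))]"

definition recommendation_at :: "'a algorithm \<Rightarrow> ('a \<Rightarrow> real) \<Rightarrow> nat \<Rightarrow> 'a" where
  "recommendation_at A f n = recommend A (observations A f n)"

definition certificate_at :: "'a algorithm \<Rightarrow> ('a \<Rightarrow> real) \<Rightarrow> nat \<Rightarrow> real" where
  "certificate_at A f n = certificate A (observations A f n)"

text \<open>Queries and recommendations lie in \<open>X\<close> for every sequence of observations. The constraints
  on the certificates, non-negativity included, concern runs on \<open>L\<close>-Lipschitz functions.\<close>

definition certified_algorithm ::
    "'a set \<Rightarrow> ('a::real_vector \<Rightarrow> real) \<Rightarrow> real \<Rightarrow> 'a algorithm \<Rightarrow> bool" where
  "certified_algorithm X N L A \<longleftrightarrow>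
     (\<forall>ys. next_query A ys \<in> X) \<and>
     (\<forall>ys. ys \<noteq> [] \<longrightarrow> recommend A ys \<in> X) \<and>
     (\<forall>f n. L_lipschitz X N L f \<and> n \<ge> 1 \<longrightarrow>
        certificate_at A f n \<ge> 0 \<and>
        max_on X f - f (recommendation_at A f n) \<le> certificate_at A f n)"

definition sample_complexity :: "'a algorithm \<Rightarrow> ('a \<Rightarrow> real) \<Rightarrow> real \<Rightarrow> enat" where
  "sample_complexity A f e = Inf {enat n | n. n \<ge> 1 \<and> certificate_at A f n \<le> e}"

section \<open>Hierarchies of cells\<close>

text \<open>\<open>children H h j\<close> lists the indices, at depth \<open>h + 1\<close>, of the children of the cell \<open>(h, j)\<close>,
  in the order in which they are processed. Only indices \<open>i < K ^ h\<close> are meaningful at depth \<open>h\<close>.\<close>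

record 'a hierarchy =
  cell :: "nat \<Rightarrow> nat \<Rightarrow> 'a set"
  repr :: "nat \<Rightarrow> nat \<Rightarrow> 'a"
  children :: "nat \<Rightarrow> nat \<Rightarrow> nat list"

definition is_hierarchy :: "'a set \<Rightarrow> nat \<Rightarrow> 'a hierarchy \<Rightarrow> bool" where
  "is_hierarchy X K H \<longleftrightarrow>
     K \<ge> 1 \<and>
     (\<forall>h. (\<forall>i<K^h. cell H h i \<noteq> {}) \<and>
          disjoint_family_on (cell H h) {..<K^h} \<and>
          X \<subseteq> (\<Union>i<K^h. cell H h i)) \<and>
     (\<forall>h. \<forall>j<K^h.
          length (children H h j) = K \<and> distinct (children H h j) \<and>
          set (children H h j) \<subseteq> {..<K^(h+1)} \<and>
          partition_on (cell H h j) (cell H (h+1) ` set (children H h j))) \<and>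
     (\<forall>h. \<forall>i<K^h. repr H h i \<in> cell H h i \<and>
          (cell H h i \<inter> X \<noteq> {} \<longrightarrow> repr H h i \<in> X))"

definition cond_D1 :: "('a::real_vector \<Rightarrow> real) \<Rightarrow> nat \<Rightarrow> 'a hierarchy \<Rightarrow> real \<Rightarrow> real \<Rightarrow> bool" where
  "cond_D1 N K H \<delta> R \<longleftrightarrow>
     0 < \<delta> \<and> \<delta> < 1 \<and> 0 < R \<and>
     (\<forall>h. \<forall>i<K^h. \<forall>u\<in>cell H h i. \<forall>v\<in>cell H h i. N (u - v) \<le> R * \<delta> ^ h)"

definition cond_D2 :: "('a::real_vector \<Rightarrow> real) \<Rightarrow> nat \<Rightarrow> 'a hierarchy \<Rightarrow> real \<Rightarrow> real \<Rightarrow> bool" where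
  "cond_D2 N K H \<delta> \<nu> \<longleftrightarrow>
     0 < \<nu> \<and>
     (\<forall>h h'. \<forall>i<K^h. \<forall>i'<K^h'. (h, i) \<noteq> (h', i') \<longrightarrow>
        N (repr H h i - repr H h' i') \<ge> \<nu> * \<delta> ^ max h h')"

section \<open>The algorithm c.DOO\<close>

text \<open>A history lists the cells whose representatives have been queried, with the values observed,
  oldest first. A choice rule breaks ties: from the current history and the set of maximizers it
  picks a maximizer.\<close>

type_synonym history = "((nat \<times> nat) \<times> real) list"
type_synonym choice_rule = "history \<Rightarrow> (nat \<times> nat) set \<Rightarrow> nat \<times> nat"

definition valid_choice_rule :: "choice_rule \<Rightarrow> bool" where
  "valid_choice_rule g \<longleftrightarrow> (\<forall>hist S. S \<noteq> {} \<longrightarrow> g hist S \<in> S)"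

definition observed :: "history \<Rightarrow> nat \<times> nat \<Rightarrow> real" where
  "observed hist c = the (map_of hist c)"

text \<open>\<open>active\<close> is the set of leaves from which cells are selected; \<open>selected\<close> is the cell selected
  in the current (or just completed) iteration, \<open>None\<close> before the first iteration; \<open>pending\<close>
  holds the cells still to be queried in the current iteration.\<close>

record doo_state =
  hist :: history
  active :: "(nat \<times> nat) set"
  selected :: "(nat \<times> nat) option"
  pending :: "(nat \<times> nat) list"

definition doo_init :: doo_state where
  "doo_init = \<lparr>hist = [], active = {(0, 0)}, selected = None, pending = [(0, 0)]\<rparr>"

text \<open>If the current iteration is complete, start the next one. For a hierarchy in the sense above,
  a selected cell meets \<open>X\<close>, so that \<open>pending\<close> is non-empty afterwards.\<close>

definition doo_prepare ::
    "'a set \<Rightarrow> real \<Rightarrow> 'a hierarchy \<Rightarrow> real \<Rightarrow> real \<Rightarrow> choice_rule \<Rightarrow> doo_state \<Rightarrow> doo_state" where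
  "doo_prepare X L H \<delta> R sel s =
     (if pending s \<noteq> [] then s
      else let c = sel (hist s)
                     {c. is_arg_max (\<lambda>c. observed (hist s) c + L * R * \<delta> ^ fst c)
                           (\<lambda>c. c \<in> active s) c}
           in s\<lparr>selected := Some c,
                pending := [(fst c + 1, j). j \<leftarrow> children H (fst c) (snd c),
                                            cell H (fst c + 1) j \<inter> X \<noteq> {}]\<rparr>)"

text \<open>Record the value \<open>y\<close> observed at the representative of the first pending cell. After the
  last child, the selected cell leaves \<open>active\<close>.\<close>

definition doo_observe :: "doo_state \<Rightarrow> real \<Rightarrow> doo_state" where
  "doo_observe s y =
     (let c = hd (pending s); rest = tl (pending s)
      in s\<lparr>hist := hist s @ [(c, y)],
           active := insert c (active s) - (if rest = [] then set_option (selected s) else {}),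
           pending := rest\<rparr>)"

definition doo_state_after ::
    "'a set \<Rightarrow> real \<Rightarrow> 'a hierarchy \<Rightarrow> real \<Rightarrow> real \<Rightarrow> choice_rule \<Rightarrow> real list \<Rightarrow> doo_state" where
  "doo_state_after X L H \<delta> R sel ys =
     foldl (\<lambda>s y. doo_observe (doo_prepare X L H \<delta> R sel s) y) doo_init ys"

definition best_cell :: "choice_rule \<Rightarrow> history \<Rightarrow> nat \<times> nat" where
  "best_cell rsel hs = rsel hs {c. is_arg_max (observed hs) (\<lambda>c. c \<in> fst ` set hs) c}"

definition cDOO ::
    "'a set \<Rightarrow> real \<Rightarrow> 'a hierarchy \<Rightarrow> real \<Rightarrow> real \<Rightarrow> choice_rule \<Rightarrow> choice_rule \<Rightarrow> 'a algorithm" where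
  "cDOO X L H \<delta> R sel rsel =
     \<lparr>next_query = (\<lambda>ys.
        let s = doo_prepare X L H \<delta> R sel (doo_state_after X L H \<delta> R sel ys);
            c = hd (pending s)
        in repr H (fst c) (snd c)),
      recommend = (\<lambda>ys.
        let s = doo_state_after X L H \<delta> R sel ys;
            c = best_cell rsel (hist s)
        in repr H (fst c) (snd c)),
      certificate = (\<lambda>ys.
        let s = doo_state_after X L H \<delta> R sel ys
        in (case selected s of
              None \<Rightarrow> L * R
            | Some c \<Rightarrow> observed (hist s) c + L * R * \<delta> ^ fst c
                        - observed (hist s) (best_cell rsel (hist s))))\<rparr>"

end

theory Submission
  imports Defs
begin

text \<open>
  Validity of the certificates. At any time the active cells cover \<open>X\<close>. By the diameter bound and
  the Lipschitz property, \<open>f x \<le> f (repr_at c) + L * R * \<delta> ^ h\<close> for every \<open>x\<close> of \<open>X\<close> in an active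
  cell \<open>c\<close> of depth \<open>h\<close>. The cell selected in an iteration maximizes the right-hand side, which is
  therefore an upper bound of \<open>f\<close> on the whole of \<open>X\<close> (\<open>selected_upper_bound\<close>); subtracting the
  best value observed so far gives the certificate. Before the first selection the certificate is
  \<open>L * R\<close>, the same bound for the root cell, which contains \<open>X\<close>.

  Sample complexity. Since the selected cell has itself been queried, a certificate is at most
  \<open>L * R * \<delta> ^ h\<close>, where \<open>h\<close> is the depth of the selected cell. So as long as all certificates exceed
  \<open>\<epsilon>\<close>, every selected cell satisfies \<open>L * R * \<delta> ^ h > \<epsilon>\<close>, and the suboptimality of its
  representative is at most \<open>L * R * \<delta> ^ h\<close> (\<open>expanded_before_stop\<close>). Hence a selected cell
  whose representative has suboptimality greater than \<open>t\<close> satisfies \<open>L * R * \<delta> ^ h > t\<close>, and the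
  representatives of cells satisfying this are more than \<open>(\<nu> / R) * (t / L)\<close> apart.
  Applied to the layers with \<open>t\<close> the lower end of the layer, and to the \<open>\<epsilon>\<close>-optimal set with \<open>t = \<epsilon>\<close>, this bounds the number of
  selected cells by a sum of packing numbers at radii \<open>(\<nu> / R) * (t / L)\<close>. A volume argument trades
  these for the radii \<open>t / L\<close> of \<open>S_C\<close>, at the cost of the factor \<open>packing_factor (\<nu> / R) d\<close>
  (\<open>separated_coarsen\<close>, \<open>card_le_S_C\<close>).

  Each selected cell is responsible for at most \<open>K\<close> queries and no cell is queried twice
  (\<open>queries_le_expanded\<close>). Counting in addition the root and the query at which the algorithm
  stops gives \<open>2 + K * packing_factor (\<nu> / R) d * S_C\<close>, and \<open>S_C \<ge> 1\<close>.
\<close>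

section \<open>Packings in an arbitrary norm\<close>

lemma norm_nonneg: "is_norm N \<Longrightarrow> 0 \<le> N x"
  and norm_eq_0: "is_norm N \<Longrightarrow> N x = 0 \<longleftrightarrow> x = 0"
  and norm_scale: "is_norm N \<Longrightarrow> N (c *\<^sub>R x) = \<bar>c\<bar> * N x"
  and norm_triangle: "is_norm N \<Longrightarrow> N (x + y) \<le> N x + N y"
  by (auto simp: is_norm_def)

lemma norm_diff_sym:
  assumes "is_norm N"
  shows "N (x - y) = N (y - x)"
  using norm_scale[OF assms, of "-1" "x - y"] by simp

lemma norm_diff_triangle:
  assumes "is_norm N"
  shows "N (x - z) \<le> N (x - y) + N (y - z)"
  using norm_triangle[OF assms, of "x - y" "y - z"] by simp

lemma norm_upper_bound:
  fixes N :: "'a::euclidean_space \<Rightarrow> real"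
  assumes N: "is_norm N"
  obtains C where "\<And>x. N x \<le> C * norm x"
proof
  fix x :: 'a
  have sub: "N (\<Sum>b\<in>A. (x \<bullet> b) *\<^sub>R b) \<le> (\<Sum>b\<in>A. \<bar>x \<bullet> b\<bar> * N b)" if "finite A" for A
    using that
  proof (induction A rule: finite_induct)
    case empty
    show ?case using norm_eq_0[OF N, of 0] by simp
  next
    case (insert b A)
    then show ?case
      using norm_triangle[OF N, of "(x \<bullet> b) *\<^sub>R b" "\<Sum>b\<in>A. (x \<bullet> b) *\<^sub>R b"] norm_scale[OF N, of "x \<bullet> b" b]
      by simp
  qed
  have "N x \<le> (\<Sum>b\<in>Basis. \<bar>x \<bullet> b\<bar> * N b)"
    using sub[of Basis] by (simp add: euclidean_representation)
  also have "\<dots> \<le> (\<Sum>b\<in>Basis. norm x * N b)"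
    by (intro sum_mono mult_right_mono Basis_le_norm norm_nonneg[OF N])
  finally show "N x \<le> (\<Sum>b\<in>Basis. N b) * norm x"
    by (simp add: sum_distrib_left sum_distrib_right mult.commute)
qed

lemma norm_continuous:
  fixes N :: "'a::euclidean_space \<Rightarrow> real"
  assumes N: "is_norm N"
  shows "continuous_on UNIV N"
proof (rule convex_on_continuous)
  show "convex_on UNIV N"
  proof (rule convex_onI)
    fix t :: real and x y :: 'a
    assume "0 < t" "t < 1"
    then show "N ((1 - t) *\<^sub>R x + t *\<^sub>R y) \<le> (1 - t) * N x + t * N y"
      using norm_triangle[OF N, of "(1 - t) *\<^sub>R x" "t *\<^sub>R y"] norm_scale[OF N] by simp
  qed simp
qed simp

text \<open>By compactness \<open>N\<close> attains a minimum on the Euclidean unit sphere; homogeneity does the rest.\<close>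

lemma norm_lower_bound:
  fixes N :: "'a::euclidean_space \<Rightarrow> real"
  assumes N: "is_norm N"
  obtains c where "c > 0" "\<And>x. c * norm x \<le> N x"
proof -
  have "\<exists>u\<in>sphere 0 1. \<forall>x\<in>sphere (0::'a) 1. N u \<le> N x"
    using norm_continuous[OF N] nonempty_Basis
    by (intro continuous_attains_inf) (auto intro: continuous_on_subset)
  then obtain u :: 'a where u: "norm u = 1" "\<And>x. norm x = 1 \<Longrightarrow> N u \<le> N x"
    by auto
  have "N u \<noteq> 0" using u(1) norm_eq_0[OF N, of u] by auto
  show thesis
  proof
    show "N u > 0" using \<open>N u \<noteq> 0\<close> norm_nonneg[OF N, of u] by simp
    show "N u * norm x \<le> N x" for x
    proof (cases "x = 0")
      case True then show ?thesis using norm_nonneg[OF N] by simp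
    next
      case False
      then have "N u \<le> N ((1 / norm x) *\<^sub>R x)" by (intro u(2)) simp
      then show ?thesis using False norm_scale[OF N, of "1 / norm x" x] by (simp add: field_simps)
    qed
  qed
qed

definition norm_ball :: "('a::real_vector \<Rightarrow> real) \<Rightarrow> 'a \<Rightarrow> real \<Rightarrow> 'a set" where
  "norm_ball N a r = {x. N (x - a) < r}"

lemma norm_ball_lmeasurable:
  fixes N :: "'a::euclidean_space \<Rightarrow> real"
  assumes N: "is_norm N"
  shows "norm_ball N a r \<in> lmeasurable"
proof (rule lmeasurable_open)
  have "continuous_on UNIV (\<lambda>x. N (x - a))"
    by (rule continuous_on_compose2[OF norm_continuous[OF N]]) (auto intro!: continuous_intros)
  then show "open (norm_ball N a r)"
    unfolding norm_ball_def by (intro open_Collect_less continuous_intros)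
  obtain c where c: "c > 0" "\<And>x. c * norm x \<le> N x" using norm_lower_bound[OF N] by blast
  have "dist a x \<le> r / c" if "x \<in> norm_ball N a r" for x
    using that c(1) c(2)[of "x - a"] unfolding norm_ball_def dist_norm
    by (simp add: pos_le_divide_eq norm_minus_commute mult.commute)
  then show "bounded (norm_ball N a r)" unfolding bounded_def by blast
qed

lemma measure_norm_ball:
  fixes N :: "'a::euclidean_space \<Rightarrow> real"
  assumes N: "is_norm N" and r: "r > 0"
  shows "measure lebesgue (norm_ball N a r) = r ^ DIM('a) * measure lebesgue (norm_ball N 0 1)"
proof -
  have "norm_ball N a r = (\<lambda>x. a + r *\<^sub>R x) ` norm_ball N 0 1"
  proof (intro equalityI subsetI)
    fix x assume "x \<in> norm_ball N a r"
    then have "N (x - a) / r < 1" using r by (simp add: norm_ball_def)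
    then have "(1 / r) *\<^sub>R (x - a) \<in> norm_ball N 0 1"
      using r norm_scale[OF N, of "1 / r" "x - a"]
      by (simp add: norm_ball_def del: scaleR_right_diff_distrib)
    moreover have "x = a + r *\<^sub>R ((1 / r) *\<^sub>R (x - a))" using r by simp
    ultimately show "x \<in> (\<lambda>x. a + r *\<^sub>R x) ` norm_ball N 0 1" by blast
  next
    fix x assume "x \<in> (\<lambda>x. a + r *\<^sub>R x) ` norm_ball N 0 1"
    then show "x \<in> norm_ball N a r"
      using r norm_scale[OF N, of r] by (auto simp: norm_ball_def)
  qed
  then show ?thesis using r measure_lebesgue_affine[of r a "norm_ball N 0 1"] by (simp add: add.commute)
qed

lemma measure_norm_ball_pos:
  fixes N :: "'a::euclidean_space \<Rightarrow> real"
  assumes N: "is_norm N"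
  shows "measure lebesgue (norm_ball N 0 1) > 0"
proof -
  obtain C where C: "\<And>x. N x \<le> C * norm x" using norm_upper_bound[OF N] by blast
  define r where "r = 1 / (\<bar>C\<bar> + 1)"
  have "r > 0" unfolding r_def by simp
  have "ball 0 r \<subseteq> norm_ball N 0 1"
  proof
    fix x :: 'a assume "x \<in> ball 0 r"
    then have "(\<bar>C\<bar> + 1) * norm x < 1" unfolding r_def by (simp add: field_simps)
    moreover have "C * norm x \<le> (\<bar>C\<bar> + 1) * norm x" by (intro mult_right_mono) auto
    ultimately show "x \<in> norm_ball N 0 1" using C[of x] by (simp add: norm_ball_def)
  qed
  then have "measure lebesgue (ball (0::'a) r) \<le> measure lebesgue (norm_ball N 0 1)"
    using norm_ball_lmeasurable[OF N] by (intro measure_mono_fmeasurable) auto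
  moreover have "measure lebesgue (ball (0::'a) r) > 0"
    using \<open>r > 0\<close> by (simp add: content_ball_pos)
  ultimately show ?thesis by linarith
qed

definition separated :: "('a::real_vector \<Rightarrow> real) \<Rightarrow> real \<Rightarrow> 'a set \<Rightarrow> bool" where
  "separated N r S \<longleftrightarrow> (\<forall>x\<in>S. \<forall>y\<in>S. x \<noteq> y \<longrightarrow> N (x - y) > r)"

text \<open>Balls of radius \<open>s / 2\<close> around the points are disjoint and lie in the ball of radius
  \<open>r + s / 2 \<le> 2 * r\<close> around \<open>a\<close>; compare the volumes.\<close>

lemma separated_in_ball_card:
  fixes N :: "'a::euclidean_space \<Rightarrow> real"
  assumes N: "is_norm N" and S: "finite S" "separated N s S"
    and ball: "\<And>x. x \<in> S \<Longrightarrow> N (x - a) \<le> r" and rs: "0 < s" "s \<le> r"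
  shows "real (card S) \<le> (4 * r / s) ^ DIM('a)"
proof -
  let ?v = "measure lebesgue (norm_ball N 0 1)"
  let ?B = "\<lambda>x. norm_ball N x (s / 2)"
  have "disjnt (?B x) (?B y)" if xy: "x \<in> S" "y \<in> S" "x \<noteq> y" for x y
    unfolding disjnt_iff
  proof clarify
    fix z assume "z \<in> ?B x" "z \<in> ?B y"
    then show False
      using norm_diff_triangle[OF N, of x y z] norm_diff_sym[OF N, of x z] S(2) xy
      unfolding separated_def norm_ball_def by fastforce
  qed
  then have "measure lebesgue (\<Union>(?B ` S)) = (\<Sum>x\<in>S. measure lebesgue (?B x))"
    using S(1) norm_ball_lmeasurable[OF N]
    by (intro measure_UNION') (auto simp: pairwise_def)
  also have "\<dots> = real (card S) * ((s / 2) ^ DIM('a) * ?v)"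
    using rs measure_norm_ball[OF N, of "s / 2"] by simp
  finally have "real (card S) * ((s / 2) ^ DIM('a) * ?v) = measure lebesgue (\<Union>(?B ` S))" ..
  also have "\<dots> \<le> measure lebesgue (norm_ball N a (2 * r))"
  proof (rule measure_mono_fmeasurable)
    show "\<Union>(?B ` S) \<subseteq> norm_ball N a (2 * r)"
    proof clarify
      fix x z assume "x \<in> S" "z \<in> ?B x"
      then show "z \<in> norm_ball N a (2 * r)"
        using norm_diff_triangle[OF N, of z a x] ball rs unfolding norm_ball_def by fastforce
    qed
    show "\<Union>(?B ` S) \<in> sets lebesgue"
      using S(1) norm_ball_lmeasurable[OF N] by (intro sets.finite_UN) auto
  qed (rule norm_ball_lmeasurable[OF N])
  also have "\<dots> = (2 * r) ^ DIM('a) * ?v" using rs by (intro measure_norm_ball[OF N]) simp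
  finally have "real (card S) * (s / 2) ^ DIM('a) \<le> (2 * r) ^ DIM('a)"
    using measure_norm_ball_pos[OF N] by (simp flip: mult.assoc)
  then have "real (card S) \<le> (2 * r) ^ DIM('a) / (s / 2) ^ DIM('a)"
    using rs by (simp add: pos_le_divide_eq)
  also have "\<dots> = (4 * r / s) ^ DIM('a)" unfolding power_divide[symmetric] by simp
  finally show ?thesis .
qed

text \<open>The price of multiplying the separation radius by \<open>1 / q\<close> in dimension \<open>d\<close>.\<close>

definition packing_factor :: "real \<Rightarrow> nat \<Rightarrow> real" where
  "packing_factor q d = of_bool (q \<ge> 1) + of_bool (q < 1) * (4 / q) ^ d"

lemma packing_factor_nonneg: "0 < q \<Longrightarrow> 0 \<le> packing_factor q d"
  by (simp add: packing_factor_def)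

text \<open>For \<open>q < 1\<close>, take for \<open>T\<close> a maximal \<open>r\<close>-separated subset of \<open>S\<close>. Maximality makes the closed balls of
  radius \<open>r\<close> around \<open>T\<close> cover \<open>S\<close>, and each of them contains boundedly many points of \<open>S\<close>. Choosing
  \<open>T\<close> inside \<open>S\<close> makes it a packing of every set that contains \<open>S\<close>.\<close>

lemma separated_coarsen:
  fixes N :: "'a::euclidean_space \<Rightarrow> real"
  assumes N: "is_norm N" and S: "finite S" "separated N (q * r) S"
    and q: "q > 0" and r: "r > 0"
  obtains T where "T \<subseteq> S" "separated N r T"
    "real (card S) \<le> packing_factor q DIM('a) * real (card T)"
proof (cases "q \<ge> 1")
  case True
  then have "r \<le> q * r" using r by simp
  then have "separated N r S" using S(2) unfolding separated_def by fastforce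
  then show thesis using True by (intro that[of S]) (auto simp: packing_factor_def)
next
  case False
  let ?P = "\<lambda>T. T \<subseteq> S \<and> separated N r T"
  have "finite {T. ?P T}" using S(1) by simp
  moreover have "?P {}" by (simp add: separated_def)
  ultimately obtain T where T: "?P T" and max: "\<And>U. ?P U \<Longrightarrow> T \<subseteq> U \<Longrightarrow> T = U"
    using finite_has_maximal[of "{T. ?P T}"] by auto
  have fT: "finite T" using T S(1) finite_subset by blast
  have cover: "\<exists>t\<in>T. N (x - t) \<le> r" if "x \<in> S" for x
  proof (rule ccontr)
    assume far: "\<not> (\<exists>t\<in>T. N (x - t) \<le> r)"
    then have "?P (insert x T)"
      using T that norm_diff_sym[OF N] unfolding separated_def
      by (metis insert_iff insert_subset linorder_not_le)
    then have "x \<in> T" using max[of "insert x T"] by auto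
    then show False using far norm_eq_0[OF N, of 0] r by auto
  qed
  let ?S = "\<lambda>t. {x \<in> S. N (x - t) \<le> r}"
  have "card S \<le> card (\<Union>(?S ` T))"
    using cover S(1) fT by (intro card_mono) auto
  also have "\<dots> \<le> (\<Sum>t\<in>T. card (?S t))" by (rule card_UN_le[OF fT])
  finally have "real (card S) \<le> (\<Sum>t\<in>T. real (card (?S t)))" by (simp flip: of_nat_sum)
  also have "\<dots> \<le> (\<Sum>t\<in>T. (4 * r / (q * r)) ^ DIM('a))"
  proof (rule sum_mono)
    fix t
    have "separated N (q * r) (?S t)" using S(2) unfolding separated_def by blast
    then show "real (card (?S t)) \<le> (4 * r / (q * r)) ^ DIM('a)"
      using S(1) False q r by (intro separated_in_ball_card[OF N, of _ _ t]) auto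
  qed
  also have "\<dots> = packing_factor q DIM('a) * real (card T)"
    using False r by (simp add: packing_factor_def)
  finally show thesis using T that by blast
qed

lemma separated_card_le_packing_number:
  assumes T: "finite T" "T \<subseteq> E" "separated N r T"
  shows "enat (card T) \<le> packing_number N E r"
proof (cases "T = {}")
  case False
  then have "E \<noteq> {}" using T by blast
  obtain x where x: "bij_betw x {..<card T} T"
    using ex_bij_betw_nat_finite[OF T(1)] by (auto simp: atLeast0LessThan)
  have "\<forall>i<card T. x i \<in> E"
    using x T(2) bij_betwE by fastforce
  moreover have "\<forall>i<card T. \<forall>j<card T. i \<noteq> j \<longrightarrow> N (x i - x j) > r"
    using x T(3) unfolding separated_def bij_betw_def inj_on_def by blast
  moreover have "card T \<ge> 1" using False T(1) by (simp add: Suc_le_eq card_gt_0_iff)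
  ultimately have "enat (card T) \<in> {enat k | k. k \<ge> 1 \<and> (\<exists>x :: nat \<Rightarrow> 'a. (\<forall>i<k. x i \<in> E) \<and>
      (\<forall>i<k. \<forall>j<k. i \<noteq> j \<longrightarrow> N (x i - x j) > r))}" by blast
  then show ?thesis
    using \<open>E \<noteq> {}\<close> unfolding packing_number_def by (simp only: if_False) (rule Sup_upper)
qed (simp flip: zero_enat_def)

section \<open>The search tree of c.DOO\<close>

text \<open>Both the selection of a cell and the recommendation are of this form.\<close>

lemma choice_of_maximizer:
  fixes b :: "nat \<times> nat \<Rightarrow> real" and hs :: history
  assumes g: "valid_choice_rule g" and A: "finite A" "A \<noteq> {}"
  defines "c \<equiv> g hs {c. is_arg_max b (\<lambda>c. c \<in> A) c}"
  shows "c \<in> A" "\<And>a. a \<in> A \<Longrightarrow> b a \<le> b c"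
proof -
  have "Max (b ` A) \<in> b ` A" using A by (intro Max_in) simp_all
  then obtain d where d: "Max (b ` A) = b d" "d \<in> A" by (rule imageE)
  have "b a \<le> b d" if "a \<in> A" for a
    unfolding d(1)[symmetric] using A that by (intro Max_ge) simp_all
  then have "d \<in> {c. is_arg_max b (\<lambda>c. c \<in> A) c}"
    using d(2) by (simp only: is_arg_max_linorder mem_Collect_eq) blast
  then have "{c. is_arg_max b (\<lambda>c. c \<in> A) c} \<noteq> {}" by (rule ex_in_conv[THEN iffD1, OF exI])
  then have "c \<in> {c. is_arg_max b (\<lambda>c. c \<in> A) c}"
    unfolding c_def by (rule g[unfolded valid_choice_rule_def, rule_format])
  then have "is_arg_max b (\<lambda>c. c \<in> A) c" by (rule CollectD)
  then show "c \<in> A" "\<And>a. a \<in> A \<Longrightarrow> b a \<le> b c"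
    by (simp_all only: is_arg_max_linorder simp_thms)
qed

locale doo =
  fixes X :: "'a::euclidean_space set" and N :: "'a \<Rightarrow> real" and L \<delta> R :: real
    and K :: nat and H :: "'a hierarchy" and sel rsel :: choice_rule
  assumes X_nonempty: "X \<noteq> {}" and X_compact: "compact X"
    and N: "is_norm N" and L_pos: "L > 0"
    and hierarchy: "is_hierarchy X K H" and D1: "cond_D1 N K H \<delta> R"
    and sel: "valid_choice_rule sel" and rsel: "valid_choice_rule rsel"
begin

lemma \<delta>_pos: "\<delta> > 0" and R_pos: "R > 0"
  using D1 by (auto simp: cond_D1_def)

abbreviation cell_at :: "nat \<times> nat \<Rightarrow> 'a set" where
  "cell_at c \<equiv> cell H (fst c) (snd c)"

abbreviation repr_at :: "nat \<times> nat \<Rightarrow> 'a" where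
  "repr_at c \<equiv> repr H (fst c) (snd c)"

text \<open>The cells that can occur in a run.\<close>

definition nodes :: "(nat \<times> nat) set" where
  "nodes = {c. snd c < K ^ fst c \<and> cell_at c \<inter> X \<noteq> {}}"

text \<open>The list that is queued when \<open>c\<close> is selected.\<close>

definition kids :: "nat \<times> nat \<Rightarrow> (nat \<times> nat) list" where
  "kids c = [(fst c + 1, j). j \<leftarrow> children H (fst c) (snd c), cell H (fst c + 1) j \<inter> X \<noteq> {}]"

lemma kids_eq:
  "kids c = map (Pair (fst c + 1)) (filter (\<lambda>j. cell H (fst c + 1) j \<inter> X \<noteq> {}) (children H (fst c) (snd c)))"
proof -
  have "concat (map (\<lambda>j. if P j then [g j] else []) js) = map g (filter P js)"
    for P and g :: "nat \<Rightarrow> nat \<times> nat" and js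
    by (induction js) auto
  then show ?thesis unfolding kids_def by simp
qed

lemma repr_in_X: "c \<in> nodes \<Longrightarrow> repr_at c \<in> X"
  and repr_in_cell: "c \<in> nodes \<Longrightarrow> repr_at c \<in> cell_at c"
  using hierarchy by (auto simp: is_hierarchy_def nodes_def)

lemma root_covers: "X \<subseteq> cell_at (0, 0)"
proof -
  have "X \<subseteq> (\<Union>i<K^0. cell H 0 i)" using hierarchy unfolding is_hierarchy_def by blast
  then show ?thesis by (simp add: lessThan_Suc)
qed

lemma root_node: "(0, 0) \<in> nodes"
  using root_covers X_nonempty by (auto simp: nodes_def)

lemma children_of_node:
  assumes "c \<in> nodes"
  shows "length (children H (fst c) (snd c)) = K" "distinct (children H (fst c) (snd c))"
    "set (children H (fst c) (snd c)) \<subseteq> {..<K ^ (fst c + 1)}"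
    "(\<Union>j\<in>set (children H (fst c) (snd c)). cell H (fst c + 1) j) = cell_at c"
proof -
  have "snd c < K ^ fst c" using assms by (simp add: nodes_def)
  then have "length (children H (fst c) (snd c)) = K \<and> distinct (children H (fst c) (snd c)) \<and>
      set (children H (fst c) (snd c)) \<subseteq> {..<K ^ (fst c + 1)} \<and>
      partition_on (cell_at c) (cell H (fst c + 1) ` set (children H (fst c) (snd c)))"
    using hierarchy unfolding is_hierarchy_def by blast
  then show "length (children H (fst c) (snd c)) = K" "distinct (children H (fst c) (snd c))"
    "set (children H (fst c) (snd c)) \<subseteq> {..<K ^ (fst c + 1)}"
    "(\<Union>j\<in>set (children H (fst c) (snd c)). cell H (fst c + 1) j) = cell_at c"
    by (simp_all add: partition_on_def)
qed

lemma kids_nodes: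
  assumes "c \<in> nodes" "a \<in> set (kids c)"
  shows "a \<in> nodes" "fst a = Suc (fst c)" "cell_at a \<subseteq> cell_at c"
  using assms(2) children_of_node(3,4)[OF assms(1)] by (auto simp: kids_eq nodes_def)

lemma kids_cover:
  assumes "c \<in> nodes"
  shows "cell_at c \<inter> X \<subseteq> (\<Union>a\<in>set (kids c). cell_at a)"
proof
  fix x assume x: "x \<in> cell_at c \<inter> X"
  then obtain j where "j \<in> set (children H (fst c) (snd c))" "x \<in> cell H (fst c + 1) j"
    using children_of_node(4)[OF assms] by blast
  then show "x \<in> (\<Union>a\<in>set (kids c). cell_at a)" using x by (auto simp: kids_eq)
qed

lemma kids_nonempty: "c \<in> nodes \<Longrightarrow> kids c \<noteq> []"
  using kids_cover[of c] by (auto simp: nodes_def)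

lemma kids_distinct: "c \<in> nodes \<Longrightarrow> distinct (kids c)"
  using children_of_node(2)[of c] by (auto simp: kids_eq distinct_map inj_on_def)

lemma kids_card:
  assumes "c \<in> nodes"
  shows "card (set (kids c)) \<le> K"
proof -
  have "card (set (kids c)) \<le> length (kids c)" by (rule card_length)
  also have "\<dots> \<le> K" using children_of_node(1)[OF assms] by (auto simp: kids_eq intro: length_filter_le[THEN order_trans])
  finally show ?thesis .
qed

text \<open>A child is a non-empty subset of each of its parents, while distinct cells of equal depth are
  disjoint.\<close>

lemma parent_unique:
  assumes c: "c \<in> nodes" and d: "d \<in> nodes" and a: "a \<in> set (kids c)" "a \<in> set (kids d)"
  shows "c = d"
proof (rule ccontr)
  assume "c \<noteq> d"
  have eq: "fst c = fst d" using kids_nodes(2)[OF c a(1)] kids_nodes(2)[OF d a(2)] by simp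
  have "disjoint_family_on (cell H (fst c)) {..<K ^ fst c}"
    using hierarchy unfolding is_hierarchy_def by blast
  moreover have "snd c \<noteq> snd d" using \<open>c \<noteq> d\<close> eq by (simp add: prod_eq_iff)
  ultimately have "cell_at c \<inter> cell_at d = {}"
    using c d eq unfolding disjoint_family_on_def nodes_def by auto
  moreover have "cell_at a \<noteq> {}" using kids_nodes(1)[OF c a(1)] by (auto simp: nodes_def)
  ultimately show False using kids_nodes(3)[OF c a(1)] kids_nodes(3)[OF d a(2)] by blast
qed

definition queried :: "doo_state \<Rightarrow> (nat \<times> nat) set" where
  "queried s = fst ` set (hist s)"

text \<open>The cells selected so far. A state does not record past selections, but a cell leaves
  \<open>active\<close> exactly when the iteration that selected it ends.\<close>

definition expanded :: "doo_state \<Rightarrow> (nat \<times> nat) set" where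
  "expanded s = (queried s - active s) \<union> set_option (selected s)"

text \<open>The clause on the selected cell concerns the middle of an iteration: the cell is still a leaf,
  but its part of \<open>X\<close> is already covered by its queried and pending children together with the
  other leaves. So it can be removed after its last child without losing the covering of \<open>X\<close>.
  The last clause says that every queried cell but the root has a parent among the expanded ones; it bounds the
  number of queries and shows that no cell is queried twice.\<close>

definition tree_inv :: "doo_state \<Rightarrow> bool" where
  "tree_inv s \<longleftrightarrow>
     queried s \<union> set (pending s) \<subseteq> nodes \<and>
     active s \<subseteq> queried s \<union> set (pending s) \<and>
     distinct (map fst (hist s) @ pending s) \<and>
     X \<subseteq> (\<Union>c\<in>active s. cell_at c) \<and>
     (\<forall>c\<in>set_option (selected s). c \<in> queried s \<and>
        (if pending s = [] then c \<notin> active s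
         else c \<in> active s \<and>
           cell_at c \<inter> X \<subseteq> (\<Union>a\<in>active s - {c} \<union> set (pending s). cell_at a))) \<and>
     queried s \<union> set (pending s) \<subseteq> insert (0, 0) (\<Union>c\<in>expanded s. set (kids c))"

lemma tree_inv_init: "tree_inv doo_init"
  using root_node root_covers
  by (simp add: tree_inv_def doo_init_def queried_def)

lemma expanded_nodes: "tree_inv s \<Longrightarrow> expanded s \<subseteq> queried s \<and> queried s \<subseteq> nodes"
  by (auto simp: tree_inv_def expanded_def)

lemma prepare_pending: "pending s \<noteq> [] \<Longrightarrow> doo_prepare X L H \<delta> R sel s = s"
  by (simp add: doo_prepare_def)

lemma prepare_select:
  assumes inv: "tree_inv s" and idle: "pending s = []"
  obtains c where "c \<in> active s"
    "\<forall>a\<in>active s.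
       observed (hist s) a + L * R * \<delta> ^ fst a \<le> observed (hist s) c + L * R * \<delta> ^ fst c"
    "doo_prepare X L H \<delta> R sel s = s\<lparr>selected := Some c, pending := kids c\<rparr>"
proof -
  let ?b = "\<lambda>c. observed (hist s) c + L * R * \<delta> ^ fst c"
  let ?M = "{c. is_arg_max ?b (\<lambda>c. c \<in> active s) c}"
  have "active s \<subseteq> fst ` set (hist s)"
    using inv idle by (simp add: tree_inv_def queried_def)
  then have "finite (active s)" by (rule finite_subset) simp
  moreover have "active s \<noteq> {}" using inv X_nonempty by (auto simp: tree_inv_def)
  ultimately have max: "sel (hist s) ?M \<in> active s"
    "\<And>a. a \<in> active s \<Longrightarrow> ?b a \<le> ?b (sel (hist s) ?M)"
    by (rule choice_of_maximizer[OF sel])+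
  have "doo_prepare X L H \<delta> R sel s =
      s\<lparr>selected := Some (sel (hist s) ?M), pending := kids (sel (hist s) ?M)\<rparr>"
    using idle by (simp add: doo_prepare_def Let_def kids_def)
  with max(1) ballI[OF max(2)] show thesis by (rule that)
qed

lemma hist_prepare [simp]: "hist (doo_prepare X L H \<delta> R sel s) = hist s"
  and active_prepare [simp]: "active (doo_prepare X L H \<delta> R sel s) = active s"
  by (auto simp: doo_prepare_def Let_def)

lemma queried_prepare [simp]: "queried (doo_prepare X L H \<delta> R sel s) = queried s"
  by (simp add: queried_def)

lemma leaf_not_expanded:
  assumes "tree_inv s" "pending s = []" "c \<in> active s"
  shows "c \<notin> expanded s"
  using assms by (auto simp: tree_inv_def expanded_def)

text \<open>A child of \<open>c\<close> that has been queried has an expanded parent, which can only be \<open>c\<close>; but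
  \<open>c\<close> is still a leaf.\<close>

lemma leaf_kids_unqueried:
  assumes inv: "tree_inv s" and idle: "pending s = []" and c: "c \<in> active s"
  shows "set (kids c) \<inter> queried s = {}"
proof (rule ccontr)
  assume "set (kids c) \<inter> queried s \<noteq> {}"
  then obtain a where a: "a \<in> set (kids c)" "a \<in> queried s" by blast
  have cn: "c \<in> nodes" using inv c idle by (auto simp: tree_inv_def)
  have "a \<noteq> (0, 0)" using kids_nodes(2)[OF cn a(1)] by auto
  then obtain d where d: "d \<in> expanded s" "a \<in> set (kids d)"
    using inv a(2) unfolding tree_inv_def by blast
  then have "c = d" using expanded_nodes[OF inv] parent_unique[OF cn _ a(1)] by blast
  then show False using d(1) leaf_not_expanded[OF inv idle c] by simp
qed

lemma expanded_prepare:
  assumes inv: "tree_inv s"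
  shows "expanded (doo_prepare X L H \<delta> R sel s) =
    expanded s \<union> set_option (selected (doo_prepare X L H \<delta> R sel s))"
proof (cases "pending s = []")
  case True
  obtain c where c: "doo_prepare X L H \<delta> R sel s = s\<lparr>selected := Some c, pending := kids c\<rparr>"
    by (rule prepare_select[OF inv True])
  have "set_option (selected s) \<subseteq> queried s - active s"
    using inv True by (auto simp: tree_inv_def)
  then show ?thesis using c by (auto simp: expanded_def queried_def)
next
  case False
  then have "doo_prepare X L H \<delta> R sel s = s" by (rule prepare_pending)
  then show ?thesis by (simp only: expanded_def Un_assoc Un_absorb)
qed

lemma tree_inv_prepare:
  assumes inv: "tree_inv s"
  shows "tree_inv (doo_prepare X L H \<delta> R sel s)" "pending (doo_prepare X L H \<delta> R sel s) \<noteq> []"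
proof -
  let ?s = "doo_prepare X L H \<delta> R sel s"
  have "tree_inv ?s \<and> pending ?s \<noteq> []"
  proof (cases "pending s = []")
    case True
    obtain c where c: "c \<in> active s" and eq: "?s = s\<lparr>selected := Some c, pending := kids c\<rparr>"
      by (rule prepare_select[OF inv True])
    have sub: "active s \<subseteq> queried s" using inv True by (simp add: tree_inv_def)
    have cn: "c \<in> nodes" using inv c sub unfolding tree_inv_def by blast
    have new: "set (kids c) \<inter> queried s = {}" by (rule leaf_kids_unqueried[OF inv True c])
    have grow: "A \<union> D \<subseteq> insert r (D \<union> B)" if "A \<subseteq> insert r B" for A B D :: "(nat \<times> nat) set" and r
      using that by blast
    have "expanded ?s = insert c (expanded s)" using expanded_prepare[OF inv] eq by simp
    then have "(\<Union>d\<in>expanded ?s. set (kids d)) = set (kids c) \<union> (\<Union>d\<in>expanded s. set (kids d))"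
      by (simp only: UN_insert)
    moreover have "queried s \<subseteq> insert (0, 0) (\<Union>d\<in>expanded s. set (kids d))"
      using inv by (simp add: tree_inv_def)
    ultimately have par: "queried s \<union> set (kids c) \<subseteq> insert (0, 0) (\<Union>d\<in>expanded ?s. set (kids d))"
      using grow by (simp only:)
    have "queried s \<union> set (kids c) \<subseteq> nodes"
      using inv kids_nodes(1)[OF cn] by (auto simp: tree_inv_def)
    moreover have "distinct (map fst (hist s) @ kids c)"
      using inv new kids_distinct[OF cn] by (auto simp: tree_inv_def queried_def)
    moreover have "cell_at c \<inter> X \<subseteq> (\<Union>a\<in>active s - {c} \<union> set (kids c). cell_at a)"
      using kids_cover[OF cn] by blast
    moreover have "X \<subseteq> (\<Union>c\<in>active s. cell_at c)" using inv by (simp add: tree_inv_def)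
    moreover have "active s \<subseteq> queried s \<union> set (kids c)" "c \<in> queried s" using sub c by auto
    ultimately have "tree_inv ?s"
      using par c kids_nonempty[OF cn] queried_prepare[of s] unfolding tree_inv_def eq by simp
    then show ?thesis using eq kids_nonempty[OF cn] by simp
  qed (use inv in \<open>simp add: prepare_pending\<close>)
  then show "tree_inv ?s" "pending ?s \<noteq> []" by auto
qed

lemma observe_fields:
  "hist (doo_observe s y) = hist s @ [(hd (pending s), y)]"
  "active (doo_observe s y) = insert (hd (pending s)) (active s) -
     (if tl (pending s) = [] then set_option (selected s) else {})"
  "selected (doo_observe s y) = selected s"
  "pending (doo_observe s y) = tl (pending s)"
  "queried (doo_observe s y) = insert (hd (pending s)) (queried s)"
  by (auto simp: doo_observe_def Let_def queried_def)

lemma observe_invariants: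
  assumes inv: "tree_inv s" and busy: "pending s \<noteq> []"
  shows "tree_inv (doo_observe s y)" "expanded (doo_observe s y) = expanded s"
proof -
  obtain p rest where p: "pending s = p # rest" using busy by (cases "pending s") auto
  have new: "p \<notin> queried s" "p \<notin> set rest" and dist: "distinct (map fst (hist s) @ [p] @ rest)"
    using inv p by (auto simp: tree_inv_def queried_def)
  show exp: "expanded (doo_observe s y) = expanded s"
    using inv p new unfolding tree_inv_def expanded_def
    by (cases "selected s"; cases "rest = []") (auto simp: observe_fields)
  have selq: "c \<in> queried s \<and> c \<in> active s \<and> c \<noteq> p \<and>
      cell_at c \<inter> X \<subseteq> (\<Union>a\<in>active s - {c} \<union> set (pending s). cell_at a)"
    if "selected s = Some c" for c
    using inv p new that by (auto simp: tree_inv_def)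
  have cover: "X \<subseteq> (\<Union>c\<in>active s. cell_at c)" using inv by (simp add: tree_inv_def)
  have "X \<subseteq> (\<Union>c\<in>active (doo_observe s y). cell_at c)"
  proof (cases "selected s")
    case None
    then show ?thesis using cover by (auto simp: observe_fields)
  next
    case (Some c)
    show ?thesis
    proof
      fix x assume x: "x \<in> X"
      show "x \<in> (\<Union>c\<in>active (doo_observe s y). cell_at c)"
      proof (cases "rest = []")
        case True
        have "active (doo_observe s y) = insert p (active s - {c})"
          using True Some p selq[OF Some] by (auto simp: observe_fields)
        moreover have "x \<in> (\<Union>a\<in>insert p (active s - {c}). cell_at a)"
        proof (cases "x \<in> cell_at c")
          case xc: True
          then show ?thesis using selq[OF Some] x p True by auto
        next
          case False
          then show ?thesis using cover x by blast
        qed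
        ultimately show ?thesis by simp
      next
        case False
        then show ?thesis using cover x p by (auto simp: observe_fields)
      qed
    qed
  qed
  moreover have "\<forall>c\<in>set_option (selected s). c \<in> insert p (queried s) \<and>
        (if rest = [] then c \<notin> active (doo_observe s y)
         else c \<in> active (doo_observe s y) \<and>
           cell_at c \<inter> X \<subseteq> (\<Union>a\<in>active (doo_observe s y) - {c} \<union> set rest. cell_at a))"
  proof
    fix c assume "c \<in> set_option (selected s)"
    then have c: "selected s = Some c" by simp
    have "c \<noteq> p" using selq[OF c] by blast
    then have "active (doo_observe s y) - {c} \<union> set rest = active s - {c} \<union> set (pending s)"
      using p c by (auto simp: observe_fields)
    moreover have "cell_at c \<inter> X \<subseteq> (\<Union>a\<in>active s - {c} \<union> set (pending s). cell_at a)"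
      using selq[OF c] by blast
    ultimately have "cell_at c \<inter> X \<subseteq> (\<Union>a\<in>active (doo_observe s y) - {c} \<union> set rest. cell_at a)"
      by (simp only:)
    moreover have "c \<in> queried s" "if rest = [] then c \<notin> active (doo_observe s y) else c \<in> active (doo_observe s y)"
      using selq[OF c] p c by (simp_all add: observe_fields)
    ultimately show "c \<in> insert p (queried s) \<and>
        (if rest = [] then c \<notin> active (doo_observe s y)
         else c \<in> active (doo_observe s y) \<and>
           cell_at c \<inter> X \<subseteq> (\<Union>a\<in>active (doo_observe s y) - {c} \<union> set rest. cell_at a))"
      by (cases "rest = []") (simp_all only: insert_iff if_True if_False simp_thms)
  qed
  moreover have "active (doo_observe s y) \<subseteq> insert p (queried s) \<union> set rest"
    using inv p by (auto simp: tree_inv_def observe_fields)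
  moreover have "insert p (queried s) \<union> set rest \<subseteq> nodes"
    "insert p (queried s) \<union> set rest \<subseteq> insert (0, 0) (\<Union>c\<in>expanded s. set (kids c))"
    using inv p by (simp_all add: tree_inv_def)
  moreover have "distinct (map fst (hist (doo_observe s y)) @ rest)"
    using dist p by (simp add: observe_fields)
  moreover have "pending (doo_observe s y) = rest" "selected (doo_observe s y) = selected s"
    "queried (doo_observe s y) = insert p (queried s)"
    using p by (simp_all add: observe_fields)
  ultimately show "tree_inv (doo_observe s y)"
    unfolding tree_inv_def exp by (simp only: simp_thms)
qed

abbreviation state_after :: "real list \<Rightarrow> doo_state" where
  "state_after \<equiv> doo_state_after X L H \<delta> R sel"

lemma state_after_Nil: "state_after [] = doo_init"
  and state_after_snoc:
    "state_after (ys @ [y]) = doo_observe (doo_prepare X L H \<delta> R sel (state_after ys)) y"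
  by (simp_all add: doo_state_after_def)

lemma tree_inv_state_after: "tree_inv (state_after ys)"
proof (induction ys rule: rev_induct)
  case (snoc y ys)
  show ?case
    unfolding state_after_snoc
    by (intro observe_invariants(1) tree_inv_prepare[OF snoc.IH])
qed (simp add: state_after_Nil tree_inv_init)

lemma length_hist: "length (hist (state_after ys)) = length ys"
  by (induction ys rule: rev_induct)
    (simp_all add: state_after_Nil state_after_snoc observe_fields(1) doo_init_def)

lemma expanded_snoc:
  "expanded (state_after (ys @ [y])) =
     expanded (state_after ys) \<union> set_option (selected (state_after (ys @ [y])))"
  unfolding state_after_snoc observe_invariants(2)[OF tree_inv_prepare[OF tree_inv_state_after]]
    observe_fields(3)
  by (rule expanded_prepare[OF tree_inv_state_after])

text \<open>Queries are pairwise distinct cells, each of them the root or a child of an expanded cell.\<close>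

lemma queries_le_expanded:
  "length ys \<le> 1 + K * card (expanded (state_after ys))"
proof -
  let ?s = "state_after ys"
  have inv: "tree_inv ?s" by (rule tree_inv_state_after)
  have fin: "finite (expanded ?s)"
    using expanded_nodes[OF inv] finite_subset unfolding queried_def by blast
  have "length ys = card (queried ?s)"
    using inv distinct_card[of "map fst (hist ?s)"] length_hist[of ys]
    by (simp add: tree_inv_def queried_def)
  also have "\<dots> \<le> card (insert (0, 0) (\<Union>c\<in>expanded ?s. set (kids c)))"
    using inv fin by (intro card_mono) (auto simp: tree_inv_def)
  also have "\<dots> \<le> 1 + card (\<Union>c\<in>expanded ?s. set (kids c))"
    using fin by (simp add: card_insert_if)
  also have "card (\<Union>c\<in>expanded ?s. set (kids c)) \<le> (\<Sum>c\<in>expanded ?s. card (set (kids c)))"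
    by (rule card_UN_le[OF fin])
  also have "\<dots> \<le> (\<Sum>c\<in>expanded ?s. K)"
    using expanded_nodes[OF inv] kids_card by (intro sum_mono) blast
  finally show ?thesis by (simp add: mult.commute)
qed

end

section \<open>Validity of the certificates\<close>

text \<open>The smallest Lipschitz constant is itself a Lipschitz constant, because each difference quotient
  is a lower bound of the set of Lipschitz constants.\<close>

lemma lipschitz_bound:
  assumes N: "is_norm N" and f: "L_lipschitz X N L f" and xy: "x \<in> X" "y \<in> X"
  shows "\<bar>f x - f y\<bar> \<le> L * N (x - y)"
proof (cases "x = y")
  case False
  then have pos: "N (x - y) > 0"
    using norm_nonneg[OF N, of "x - y"] norm_eq_0[OF N, of "x - y"] by simp
  have "\<bar>f x - f y\<bar> / N (x - y) \<le> Inf (lip_bounds X N f)"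
  proof (rule cInf_greatest)
    show "lip_bounds X N f \<noteq> {}" using f by (simp add: L_lipschitz_def lipschitz_fun_def)
    show "\<bar>f x - f y\<bar> / N (x - y) \<le> C" if "C \<in> lip_bounds X N f" for C
      using that xy pos by (simp add: lip_bounds_def pos_divide_le_eq)
  qed
  also have "\<dots> \<le> L" using f by (simp add: L_lipschitz_def Lip_def)
  finally show ?thesis using pos by (simp add: pos_divide_le_eq)
qed (use norm_eq_0[OF N, of 0] in simp)

text \<open>Compactness makes the supremum in \<open>eps0\<close> finite.\<close>

lemma eps0_ge:
  fixes N :: "'a::euclidean_space \<Rightarrow> real"
  assumes N: "is_norm N" and X: "compact X" and L: "L > 0" and xy: "x \<in> X" "y \<in> X"
  shows "L * N (x - y) \<le> eps0 X N L"
proof -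
  obtain C where C: "\<And>x. N x \<le> C * norm x" using norm_upper_bound[OF N] by blast
  obtain B where B: "\<And>x. x \<in> X \<Longrightarrow> norm x \<le> B"
    using compact_imp_bounded[OF X] by (auto simp: bounded_iff)
  have "N (u - v) \<le> \<bar>C\<bar> * (B + B)" if "u \<in> X" "v \<in> X" for u v
  proof -
    have "N (u - v) \<le> \<bar>C\<bar> * norm (u - v)"
      using C[of "u - v"] mult_right_mono[OF abs_ge_self[of C] norm_ge_zero[of "u - v"]] by linarith
    also have "norm (u - v) \<le> B + B"
      using norm_triangle_ineq4[of u v] B[OF that(1)] B[OF that(2)] by linarith
    finally show ?thesis by (simp add: mult_left_mono)
  qed
  then have "bdd_above ((\<lambda>(x, y). N (x - y)) ` (X \<times> X))" by (intro bdd_aboveI2) auto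
  then have "(\<lambda>(x, y). N (x - y)) (x, y) \<le> (SUP (x, y)\<in>X \<times> X. N (x - y))"
    using xy by (intro cSUP_upper) auto
  then show ?thesis unfolding eps0_def using L by simp
qed

context doo
begin

abbreviation algorithm_cDOO :: "'a algorithm" where
  "algorithm_cDOO \<equiv> cDOO X L H \<delta> R sel rsel"

lemma next_query_eq:
  "next_query algorithm_cDOO ys = repr_at (hd (pending (doo_prepare X L H \<delta> R sel (state_after ys))))"
  by (simp add: cDOO_def Let_def)

lemma next_query_in_X: "next_query algorithm_cDOO ys \<in> X"
proof -
  let ?s = "doo_prepare X L H \<delta> R sel (state_after ys)"
  have "hd (pending ?s) \<in> set (pending ?s)"
    by (rule hd_in_set[OF tree_inv_prepare(2)[OF tree_inv_state_after]])
  moreover have "set (pending ?s) \<subseteq> nodes"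
    using tree_inv_prepare(1)[OF tree_inv_state_after] by (simp add: tree_inv_def)
  ultimately show ?thesis unfolding next_query_eq by (intro repr_in_X) blast
qed

lemma best_cell_maximal:
  assumes "ys \<noteq> []"
  defines "s \<equiv> state_after ys"
  shows "best_cell rsel (hist s) \<in> queried s"
    "\<And>c. c \<in> queried s \<Longrightarrow> observed (hist s) c \<le> observed (hist s) (best_cell rsel (hist s))"
proof -
  have "hist s \<noteq> []" using assms length_hist[of ys] by auto
  then have "finite (fst ` set (hist s))" "fst ` set (hist s) \<noteq> {}" by simp_all
  then show "best_cell rsel (hist s) \<in> queried s"
    "\<And>c. c \<in> queried s \<Longrightarrow> observed (hist s) c \<le> observed (hist s) (best_cell rsel (hist s))"
    unfolding best_cell_def queried_def by (rule choice_of_maximizer[OF rsel])+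
qed

lemma recommend_eq:
  "recommend algorithm_cDOO ys = repr_at (best_cell rsel (hist (state_after ys)))"
  by (simp add: cDOO_def Let_def)

lemma recommend_in_X:
  assumes "ys \<noteq> []"
  shows "recommend algorithm_cDOO ys \<in> X"
  unfolding recommend_eq
  using best_cell_maximal(1)[OF assms] expanded_nodes[OF tree_inv_state_after]
  by (intro repr_in_X) blast

end

locale doo_run = doo +
  fixes f :: "'a \<Rightarrow> real"
  assumes f: "L_lipschitz X N L f"
begin

lemma f_diff: "x \<in> X \<Longrightarrow> y \<in> X \<Longrightarrow> f x - f y \<le> L * N (x - y)"
  using lipschitz_bound[OF N f] by fastforce

lemma f_le_max:
  assumes "x \<in> X"
  shows "f x \<le> max_on X f"
proof -
  have "f y \<le> f x + eps0 X N L" if "y \<in> X" for y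
    using f_diff[OF that assms] eps0_ge[OF N X_compact L_pos that assms] by linarith
  then have "bdd_above (f ` X)" by (intro bdd_aboveI2)
  then show ?thesis unfolding max_on_def using assms by (intro cSUP_upper)
qed

lemma max_le:
  assumes "\<And>x. x \<in> X \<Longrightarrow> f x \<le> b"
  shows "max_on X f \<le> b"
  unfolding max_on_def using X_nonempty assms by (intro cSUP_least)

lemma gap_le_eps0:
  assumes "x \<in> X"
  shows "max_on X f - f x \<le> eps0 X N L"
proof -
  have "max_on X f \<le> f x + eps0 X N L"
    using f_diff[OF _ assms] eps0_ge[OF N X_compact L_pos _ assms] by (intro max_le) fastforce
  then show ?thesis by linarith
qed

lemma near_opt_nonempty:
  assumes "\<epsilon> > 0"
  shows "near_opt X f \<epsilon> \<noteq> {}"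
proof
  assume "near_opt X f \<epsilon> = {}"
  then have "f x \<le> max_on X f - \<epsilon>" if "x \<in> X" for x
    using that by (force simp: near_opt_def)
  then show False using max_le[of "max_on X f - \<epsilon>"] assms by simp
qed

lemma cell_upper_bound:
  assumes "c \<in> nodes" "x \<in> cell_at c" "x \<in> X"
  shows "f x \<le> f (repr_at c) + L * R * \<delta> ^ fst c"
proof -
  have "snd c < K ^ fst c" using assms(1) by (simp add: nodes_def)
  then have "N (x - repr_at c) \<le> R * \<delta> ^ fst c"
    using D1 assms repr_in_cell[OF assms(1)] unfolding cond_D1_def by blast
  then have "L * N (x - repr_at c) \<le> L * (R * \<delta> ^ fst c)" using L_pos by simp
  then show ?thesis using f_diff[OF assms(3) repr_in_X[OF assms(1)]] by simp
qed

definition faithful :: "doo_state \<Rightarrow> bool" where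
  "faithful s \<longleftrightarrow> (\<forall>p\<in>set (hist s). snd p = f (repr_at (fst p)))"

lemma observed_faithful:
  assumes "faithful s" "c \<in> queried s"
  shows "observed (hist s) c = f (repr_at c)"
proof -
  obtain y where y: "map_of (hist s) c = Some y"
    using assms(2) map_of_eq_None_iff[of "hist s" c] unfolding queried_def by blast
  then have "y = f (repr_at c)"
    using assms(1) map_of_SomeD[OF y] unfolding faithful_def by fastforce
  then show ?thesis using y by (simp add: observed_def)
qed

definition state :: "nat \<Rightarrow> doo_state" where
  "state n = state_after (observations algorithm_cDOO f n)"

lemma state_Suc:
  "state (Suc n) = (let s = doo_prepare X L H \<delta> R sel (state n)
     in doo_observe s (f (repr_at (hd (pending s)))))"
  by (simp add: state_def state_after_snoc next_query_eq Let_def)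

lemma length_observations: "length (observations A f n) = n"
  by (induction n) simp_all

lemma tree_inv_state: "tree_inv (state n)"
  unfolding state_def by (rule tree_inv_state_after)

lemma faithful_state: "faithful (state n)"
proof (induction n)
  case 0
  show ?case by (simp add: faithful_def state_def state_after_Nil doo_init_def)
next
  case (Suc n)
  then show ?case by (simp add: faithful_def state_Suc Let_def observe_fields(1))
qed

text \<open>The leaves cover \<open>X\<close> and the selected one has the largest upper bound. The bound does not
  involve the observations made later in the iteration, so it survives until the next selection.\<close>

lemma selected_upper_bound:
  "selected (state n) = Some c \<Longrightarrow> max_on X f \<le> f (repr_at c) + L * R * \<delta> ^ fst c"
proof (induction n)
  case 0
  then show ?case by (simp add: state_def state_after_Nil doo_init_def)
next
  case (Suc n)
  let ?s = "state n"
  have sel_c: "selected (doo_prepare X L H \<delta> R sel ?s) = Some c"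
    using Suc.prems by (simp add: state_Suc Let_def observe_fields(3))
  show ?case
  proof (cases "pending ?s = []")
    case False
    then have "doo_prepare X L H \<delta> R sel ?s = ?s" by (rule prepare_pending)
    then show ?thesis using sel_c by (intro Suc.IH) simp
  next
    case True
    obtain d where d: "d \<in> active ?s"
      and dmax: "\<forall>a\<in>active ?s. observed (hist ?s) a + L * R * \<delta> ^ fst a
        \<le> observed (hist ?s) d + L * R * \<delta> ^ fst d"
      and eq: "doo_prepare X L H \<delta> R sel ?s = ?s\<lparr>selected := Some d, pending := kids d\<rparr>"
      by (rule prepare_select[OF tree_inv_state True])
    have cd: "c = d" using sel_c eq by simp
    have sub: "active ?s \<subseteq> queried ?s" and nodes: "queried ?s \<subseteq> nodes"
      and cover: "X \<subseteq> (\<Union>a\<in>active ?s. cell_at a)"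
      using tree_inv_state[of n] True by (simp_all add: tree_inv_def)
    show ?thesis
    proof (rule max_le)
      fix x assume x: "x \<in> X"
      then obtain a where a: "a \<in> active ?s" "x \<in> cell_at a" using cover by blast
      have "f x \<le> f (repr_at a) + L * R * \<delta> ^ fst a"
        using a sub nodes x by (intro cell_upper_bound) blast+
      also have "\<dots> \<le> f (repr_at d) + L * R * \<delta> ^ fst d"
        using bspec[OF dmax a(1)] observed_faithful[OF faithful_state] sub a(1) d by (metis subsetD)
      finally show "f x \<le> f (repr_at c) + L * R * \<delta> ^ fst c" using cd by simp
    qed
  qed
qed

lemma recommendation_best:
  assumes "n \<ge> 1"
  shows "recommendation_at algorithm_cDOO f n \<in> X"
    "c \<in> queried (state n) \<Longrightarrow> f (repr_at c) \<le> f (recommendation_at algorithm_cDOO f n)"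
    "observed (hist (state n)) (best_cell rsel (hist (state n)))
      = f (recommendation_at algorithm_cDOO f n)"
proof -
  have ne: "observations algorithm_cDOO f n \<noteq> []"
    using assms length_observations[of algorithm_cDOO n] by auto
  show "recommendation_at algorithm_cDOO f n \<in> X"
    unfolding recommendation_at_def by (rule recommend_in_X[OF ne])
  show best: "observed (hist (state n)) (best_cell rsel (hist (state n)))
      = f (recommendation_at algorithm_cDOO f n)"
    unfolding recommendation_at_def recommend_eq
    using observed_faithful[OF faithful_state] best_cell_maximal(1)[OF ne] by (simp add: state_def)
  show "f (repr_at c) \<le> f (recommendation_at algorithm_cDOO f n)" if "c \<in> queried (state n)"
    using best_cell_maximal(2)[OF ne, of c] that observed_faithful[OF faithful_state that]
    unfolding best[symmetric] by (simp add: state_def)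
qed

lemma certificate_eq:
  assumes "n \<ge> 1"
  shows "certificate_at algorithm_cDOO f n = (case selected (state n) of None \<Rightarrow> L * R
    | Some c \<Rightarrow> f (repr_at c) + L * R * \<delta> ^ fst c - f (recommendation_at algorithm_cDOO f n))"
proof (cases "selected (state n)")
  case None
  then show ?thesis by (simp add: certificate_at_def cDOO_def Let_def state_def)
next
  case (Some c)
  then have "observed (hist (state n)) c = f (repr_at c)"
    using tree_inv_state[of n] by (intro observed_faithful[OF faithful_state]) (simp add: tree_inv_def)
  then show ?thesis
    using Some recommendation_best(3)[OF assms]
    by (simp add: certificate_at_def cDOO_def Let_def state_def)
qed

lemma certificate_valid:
  assumes n: "n \<ge> 1"
  shows "max_on X f - f (recommendation_at algorithm_cDOO f n) \<le> certificate_at algorithm_cDOO f n"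
proof (cases "selected (state n)")
  case None
  let ?x = "recommendation_at algorithm_cDOO f n"
  have x: "?x \<in> X" by (rule recommendation_best(1)[OF n])
  have "f y \<le> f ?x + L * R" if y: "y \<in> X" for y
  proof -
    have "K ^ 0 > (0::nat)" by simp
    then have "N (y - ?x) \<le> R * \<delta> ^ 0"
      using D1 x y root_covers unfolding cond_D1_def fst_conv snd_conv by blast
    then have "L * N (y - ?x) \<le> L * R" using L_pos by simp
    then show ?thesis using f_diff[OF y x] by simp
  qed
  then have "max_on X f \<le> f ?x + L * R" by (rule max_le)
  then show ?thesis using None by (simp add: certificate_eq[OF n])
next
  case (Some c)
  then show ?thesis using selected_upper_bound[OF Some] by (simp add: certificate_eq[OF n])
qed

lemma certificate_nonneg:
  assumes "n \<ge> 1"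
  shows "certificate_at algorithm_cDOO f n \<ge> 0"
  using certificate_valid[OF assms] f_le_max[OF recommendation_best(1)[OF assms]] by linarith

end

lemma (in doo) cDOO_certified: "certified_algorithm X N L algorithm_cDOO"
  unfolding certified_algorithm_def
proof (intro conjI allI impI)
  fix f :: "'a \<Rightarrow> real" and n :: nat
  assume fn: "L_lipschitz X N L f \<and> 1 \<le> n"
  then interpret doo_run X N L \<delta> R K H sel rsel f by unfold_locales simp
  show "0 \<le> certificate_at algorithm_cDOO f n"
    "max_on X f - f (recommendation_at algorithm_cDOO f n) \<le> certificate_at algorithm_cDOO f n"
    using fn certificate_nonneg certificate_valid by auto
qed (rule next_query_in_X recommend_in_X, assumption?)+

section \<open>Sample complexity\<close>

text \<open>The relevant \<open>k\<close> is the first one at which the scale drops below \<open>t\<close>.\<close>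

lemma scale_cover:
  assumes \<epsilon>: "0 < \<epsilon>" "\<epsilon> \<le> e0" and t: "\<epsilon> < t" "t \<le> e0"
  obtains k where "k \<in> {1..num_scales e0 \<epsilon>}" "scale e0 \<epsilon> k < t" "t \<le> scale e0 \<epsilon> (k - 1)"
proof -
  let ?m = "num_scales e0 \<epsilon>"
  let ?k = "LEAST k. scale e0 \<epsilon> k < t"
  have "1 < e0 / \<epsilon>" using \<epsilon> t by (simp add: pos_less_divide_eq)
  then have "log 2 (e0 / \<epsilon>) > 0" by simp
  then have "?m \<noteq> 0" unfolding num_scales_def by linarith
  then have "\<not> scale e0 \<epsilon> 0 < t" using t by (simp add: scale_def)
  moreover have m: "scale e0 \<epsilon> ?m < t" using t by (simp add: scale_def)
  then have k: "scale e0 \<epsilon> ?k < t" by (rule LeastI)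
  ultimately have "?k \<noteq> 0" by metis
  moreover have "?k \<le> ?m" using m by (rule Least_le)
  moreover have "\<not> scale e0 \<epsilon> (?k - 1) < t" using \<open>?k \<noteq> 0\<close> by (intro not_less_Least) simp
  ultimately show thesis using k by (intro that[of ?k]) auto
qed

lemma scale_pos: "0 < \<epsilon> \<Longrightarrow> 0 < e0 \<Longrightarrow> 0 < scale e0 \<epsilon> k"
  by (simp add: scale_def)

locale doo_separated_run = doo_run +
  fixes \<nu> :: real
  assumes D2: "cond_D2 N K H \<delta> \<nu>"
begin

lemma \<nu>_pos: "\<nu> > 0"
  using D2 by (simp add: cond_D2_def)

text \<open>Consider the first query after the selection of \<open>c\<close>. The recommended value is at least
  \<open>f (repr_at c)\<close>, so that the certificate, which exceeds \<open>\<epsilon>\<close>, is at most \<open>L * R * \<delta> ^ fst c\<close>.\<close>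

lemma expanded_before_stop:
  assumes "\<And>m. 1 \<le> m \<Longrightarrow> m \<le> n \<Longrightarrow> \<epsilon> < certificate_at algorithm_cDOO f m"
    and "c \<in> expanded (state n)"
  shows "\<epsilon> < L * R * \<delta> ^ fst c \<and> max_on X f - f (repr_at c) \<le> L * R * \<delta> ^ fst c"
  using assms
proof (induction n)
  case 0
  then show ?case
    by (simp add: state_def state_after_Nil doo_init_def expanded_def queried_def)
next
  case (Suc n)
  show ?case
  proof (cases "c \<in> expanded (state n)")
    case True
    then show ?thesis using Suc.IH Suc.prems(1) by simp
  next
    case False
    then have sel_c: "selected (state (Suc n)) = Some c"
      using Suc.prems(2) by (simp add: state_def expanded_snoc)
    then have "c \<in> queried (state (Suc n))"
      using tree_inv_state[of "Suc n"] by (simp add: tree_inv_def)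
    then have "f (repr_at c) \<le> f (recommendation_at algorithm_cDOO f (Suc n))"
      by (intro recommendation_best(2)) simp_all
    moreover have "\<epsilon> < f (repr_at c) + L * R * \<delta> ^ fst c - f (recommendation_at algorithm_cDOO f (Suc n))"
      using Suc.prems(1)[of "Suc n"] sel_c by (simp add: certificate_eq)
    ultimately show ?thesis using selected_upper_bound[OF sel_c] by linarith
  qed
qed

text \<open>By the separation condition, the representatives of these cells are more than
  \<open>\<nu> * \<rho> / (L * R)\<close> apart.\<close>

lemma region_card:
  assumes D: "finite D" "D \<subseteq> nodes" and E: "\<And>c. c \<in> D \<Longrightarrow> repr_at c \<in> E"
    and large: "\<And>c. c \<in> D \<Longrightarrow> \<rho> < L * R * \<delta> ^ fst c" and \<rho>: "\<rho> > 0"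
  shows "\<exists>q. enat q \<le> packing_number N E (\<rho> / L) \<and>
    real (card D) \<le> packing_factor (\<nu> / R) DIM('a) * real q"
proof -
  have sep: "N (repr_at c - repr_at d) > \<nu> / R * (\<rho> / L)" if cd: "c \<in> D" "d \<in> D" "c \<noteq> d" for c d
  proof -
    have "\<rho> < L * R * \<delta> ^ max (fst c) (fst d)"
      using large cd by (simp add: max_def)
    then have "\<nu> / R * (\<rho> / L) < \<nu> * \<delta> ^ max (fst c) (fst d)"
      using L_pos R_pos \<nu>_pos by (simp add: field_simps)
    also have "\<dots> \<le> N (repr_at c - repr_at d)"
    proof -
      have "snd c < K ^ fst c" "snd d < K ^ fst d" "(fst c, snd c) \<noteq> (fst d, snd d)"
        using cd D(2) by (auto simp: nodes_def)
      then show ?thesis using D2 unfolding cond_D2_def by blast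
    qed
    finally show ?thesis .
  qed
  have pos: "\<nu> / R * (\<rho> / L) > 0" using L_pos R_pos \<nu>_pos \<rho> by simp
  have "inj_on repr_at D"
  proof (rule inj_onI, rule ccontr)
    fix c d assume cd: "c \<in> D" "d \<in> D" "repr_at c = repr_at d" "c \<noteq> d"
    then show False using sep[OF cd(1,2,4)] pos norm_eq_0[OF N, of 0] by simp
  qed
  then have card: "card (repr_at ` D) = card D" by (rule card_image)
  have sep_D: "separated N (\<nu> / R * (\<rho> / L)) (repr_at ` D)"
    unfolding separated_def
  proof (intro ballI impI)
    fix x y assume xy: "x \<in> repr_at ` D" "y \<in> repr_at ` D" "x \<noteq> y"
    obtain c where c: "x = repr_at c" "c \<in> D" using xy(1) by (rule imageE)
    obtain d where d: "y = repr_at d" "d \<in> D" using xy(2) by (rule imageE)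
    have "c \<noteq> d" using xy(3) c(1) d(1) by metis
    then show "\<nu> / R * (\<rho> / L) < N (x - y)" unfolding c(1) d(1) by (rule sep[OF c(2) d(2)])
  qed
  have q: "\<nu> / R > 0" and r: "\<rho> / L > 0" using L_pos R_pos \<nu>_pos \<rho> by simp_all
  obtain T where T: "T \<subseteq> repr_at ` D" "separated N (\<rho> / L) T"
    "real (card (repr_at ` D)) \<le> packing_factor (\<nu> / R) DIM('a) * real (card T)"
    by (rule separated_coarsen[OF N finite_imageI[OF D(1)] sep_D q r])
  have "finite T" by (rule finite_subset[OF T(1) finite_imageI[OF D(1)]])
  moreover have "T \<subseteq> E" using T(1) E by blast
  ultimately have "enat (card T) \<le> packing_number N E (\<rho> / L)"
    using T(2) by (rule separated_card_le_packing_number)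
  then show ?thesis using T(3) card by auto
qed

text \<open>The near-optimal set and the layers cover \<open>X\<close>. In the layer above scale \<open>\<epsilon>\<^sub>k\<close>, the hypothesis \<open>gap\<close>
  makes \<open>\<epsilon>\<^sub>k\<close> a lower bound for \<open>L * R * \<delta> ^ fst c\<close>; in the near-optimal set \<open>\<epsilon>\<close> is one.\<close>

lemma card_le_S_C:
  assumes D: "finite D" "D \<subseteq> nodes" and \<epsilon>: "0 < \<epsilon>" "\<epsilon> \<le> eps0 X N L"
    and large: "\<And>c. c \<in> D \<Longrightarrow> \<epsilon> < L * R * \<delta> ^ fst c"
    and gap: "\<And>c. c \<in> D \<Longrightarrow> max_on X f - f (repr_at c) \<le> L * R * \<delta> ^ fst c"
  shows "\<exists>q. enat q \<le> S_C X N L f \<epsilon> \<and>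
    real (card D) \<le> packing_factor (\<nu> / R) DIM('a) * real q"
proof -
  define e0 m where "e0 = eps0 X N L" and "m = num_scales e0 \<epsilon>"
  \<comment> \<open>The near-optimal set takes part in the sum over scales as term \<open>0\<close>.\<close>
  define E where "E k = (if k = 0 then near_opt X f \<epsilon>
    else layer X f (scale e0 \<epsilon> k) (scale e0 \<epsilon> (k - 1)))" for k
  define \<rho> where "\<rho> k = (if k = 0 then \<epsilon> else scale e0 \<epsilon> k)" for k
  let ?D = "\<lambda>k. {c \<in> D. repr_at c \<in> E k}"
  have "e0 > 0" using \<epsilon> by (simp add: e0_def)
  have "\<rho> k < L * R * \<delta> ^ fst c" if "c \<in> ?D k" for k c
    using that large[of c] gap[of c] by (auto simp: \<rho>_def E_def layer_def)
  then have "\<exists>q. enat q \<le> packing_number N (E k) (\<rho> k / L) \<and>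
      real (card (?D k)) \<le> packing_factor (\<nu> / R) DIM('a) * real q" for k
    using D \<epsilon> scale_pos[OF \<epsilon>(1) \<open>e0 > 0\<close>]
    by (intro region_card) (auto simp: \<rho>_def)
  then have "\<exists>q. \<forall>k. enat (q k) \<le> packing_number N (E k) (\<rho> k / L) \<and>
      real (card (?D k)) \<le> packing_factor (\<nu> / R) DIM('a) * real (q k)"
    by (intro choice allI)
  then obtain q where q: "\<And>k. enat (q k) \<le> packing_number N (E k) (\<rho> k / L)"
    "\<And>k. real (card (?D k)) \<le> packing_factor (\<nu> / R) DIM('a) * real (q k)"
    by blast
  have cover: "D \<subseteq> (\<Union>k\<in>{0..m}. ?D k)"
  proof
    fix c assume c: "c \<in> D"
    then have x: "repr_at c \<in> X" using D(2) repr_in_X by blast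
    show "c \<in> (\<Union>k\<in>{0..m}. ?D k)"
    proof (cases "max_on X f - f (repr_at c) \<le> \<epsilon>")
      case True
      then have "c \<in> ?D 0" using c x by (simp add: E_def near_opt_def)
      then show ?thesis by (intro UN_I[of 0]) simp_all
    next
      case False
      then obtain k where k: "k \<in> {1..m}" "scale e0 \<epsilon> k < max_on X f - f (repr_at c)"
        "max_on X f - f (repr_at c) \<le> scale e0 \<epsilon> (k - 1)"
        using scale_cover[of \<epsilon> e0 "max_on X f - f (repr_at c)"] \<epsilon> gap_le_eps0[OF x]
        unfolding m_def e0_def by (metis linorder_not_le)
      then have "c \<in> ?D k" using c x by (simp add: E_def layer_def)
      then show ?thesis using k(1) by (intro UN_I[of k]) simp_all
    qed
  qed
  have "card D \<le> card (\<Union>k\<in>{0..m}. ?D k)" using D(1) cover by (intro card_mono) auto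
  also have "\<dots> \<le> (\<Sum>k\<in>{0..m}. card (?D k))" by (rule card_UN_le) simp
  finally have "real (card D) \<le> (\<Sum>k\<in>{0..m}. real (card (?D k)))" by (simp flip: of_nat_sum)
  also have "\<dots> \<le> (\<Sum>k\<in>{0..m}. packing_factor (\<nu> / R) DIM('a) * real (q k))"
    by (intro sum_mono q(2))
  also have "\<dots> = packing_factor (\<nu> / R) DIM('a) * real (\<Sum>k\<in>{0..m}. q k)"
    by (simp add: sum_distrib_left)
  finally have 1: "real (card D) \<le> packing_factor (\<nu> / R) DIM('a) * real (\<Sum>k\<in>{0..m}. q k)" .
  have "enat (\<Sum>k\<in>{0..m}. q k) = (\<Sum>k\<in>{0..m}. enat (q k))"
    by (simp flip: of_nat_eq_enat)
  also have "\<dots> \<le> (\<Sum>k\<in>{0..m}. packing_number N (E k) (\<rho> k / L))" by (intro sum_mono q(1))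
  also have "\<dots> = S_C X N L f \<epsilon>"
    by (simp add: S_C_def Let_def sum.atLeast_Suc_atMost E_def \<rho>_def flip: e0_def m_def)
  finally show ?thesis using 1 by blast
qed

lemma S_C_ge_1:
  assumes "\<epsilon> > 0"
  shows "1 \<le> S_C X N L f \<epsilon>"
proof -
  obtain x where x: "x \<in> near_opt X f \<epsilon>" using near_opt_nonempty[OF assms] by blast
  have "enat (card {x}) \<le> packing_number N (near_opt X f \<epsilon>) (\<epsilon> / L)"
    using x by (intro separated_card_le_packing_number) (auto simp: separated_def)
  also have "\<dots> \<le> S_C X N L f \<epsilon>" by (simp add: S_C_def Let_def)
  finally show ?thesis by (simp add: one_enat_def)
qed

text \<open>While the algorithm runs, the number of queries stays below a fixed bound, so it stops, at the
  latest one query after that bound.\<close>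

lemma cDOO_sample_complexity:
  assumes \<epsilon>: "0 < \<epsilon>" "\<epsilon> \<le> eps0 X N L"
  shows "ereal_of_enat (sample_complexity algorithm_cDOO f \<epsilon>)
    \<le> ereal (2 + real K * packing_factor (\<nu> / R) DIM('a)) * ereal_of_enat (S_C X N L f \<epsilon>)"
proof -
  let ?a = "packing_factor (\<nu> / R) DIM('a)"
  have a: "?a \<ge> 0" using \<nu>_pos R_pos by (intro packing_factor_nonneg) simp
  show ?thesis
  proof (cases "S_C X N L f \<epsilon>")
    case infinity
    have "0 < 2 + real K * ?a" using a by (intro add_pos_nonneg) simp_all
    then show ?thesis using infinity by simp
  next
    case (enat s)
    have s: "s \<ge> 1" using S_C_ge_1[OF \<epsilon>(1)] enat by (simp add: one_enat_def)
    have running: "real n \<le> 1 + real K * ?a * real s"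
      if run: "\<And>m. 1 \<le> m \<Longrightarrow> m \<le> n \<Longrightarrow> \<epsilon> < certificate_at algorithm_cDOO f m" for n
    proof -
      let ?D = "expanded (state n)"
      have sub: "?D \<subseteq> queried (state n)" "queried (state n) \<subseteq> nodes"
        using expanded_nodes[OF tree_inv_state] by blast+
      have "finite ?D" by (rule finite_subset[OF sub(1)]) (simp add: queried_def)
      moreover have "?D \<subseteq> nodes" using sub by (rule order_trans)
      ultimately obtain q where q: "enat q \<le> S_C X N L f \<epsilon>" "real (card ?D) \<le> ?a * real q"
        using card_le_S_C[of ?D \<epsilon>] \<epsilon> expanded_before_stop[OF run] by blast
      have "n \<le> 1 + K * card ?D"
        using queries_le_expanded[of "observations algorithm_cDOO f n"]
        by (simp add: length_observations state_def)
      then have "real n \<le> 1 + real K * real (card ?D)"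
        by (metis of_nat_1 of_nat_add of_nat_le_iff of_nat_mult)
      also have "real (card ?D) \<le> ?a * real s"
      proof -
        have "real q \<le> real s" using q(1) enat by simp
        then have "?a * real q \<le> ?a * real s" using a by (rule mult_left_mono)
        with q(2) show ?thesis by linarith
      qed
      finally show ?thesis by (simp add: mult_left_mono mult.assoc)
    qed
    let ?P = "\<lambda>n. n \<ge> 1 \<and> certificate_at algorithm_cDOO f n \<le> \<epsilon>"
    have "\<exists>n. ?P n"
    proof (rule ccontr)
      assume "\<nexists>n. ?P n"
      then have "real n \<le> 1 + real K * ?a * real s" for n
        by (intro running) (meson linorder_not_le)
      then show False using reals_Archimedean2 linorder_not_le by blast
    qed
    define n where "n = (LEAST n. ?P n)"
    have n: "?P n" unfolding n_def using \<open>\<exists>n. ?P n\<close> by (rule LeastI_ex)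
    have "real (n - 1) \<le> 1 + real K * ?a * real s"
    proof (rule running)
      fix m assume "1 \<le> m" "m \<le> n - 1"
      then have "m < n" using n by linarith
      then show "\<epsilon> < certificate_at algorithm_cDOO f m"
        using not_less_Least[of m ?P] \<open>1 \<le> m\<close> unfolding n_def by linarith
    qed
    then have "real n \<le> 2 * 1 + real K * ?a * real s" using n by (simp add: of_nat_diff)
    also have "\<dots> \<le> 2 * real s + real K * ?a * real s" using s by simp
    finally have "real n \<le> (2 + real K * ?a) * real s" by (simp add: distrib_right)
    moreover have "sample_complexity algorithm_cDOO f \<epsilon> \<le> enat n"
      unfolding sample_complexity_def using n by (intro Inf_lower) blast
    then have "ereal_of_enat (sample_complexity algorithm_cDOO f \<epsilon>) \<le> ereal (real n)"
      by (metis ereal_of_enat_le_iff ereal_of_enat_simps(1))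
    ultimately show ?thesis using enat by (auto intro: order_trans)
  qed
qed

end

theorem proposition1:
  fixes X :: "(real ^ 'd) set"
    and N :: "real ^ 'd \<Rightarrow> real"
    and L \<delta> R \<nu> :: real
    and K :: nat
    and H :: "(real ^ 'd) hierarchy"
    and sel rsel :: choice_rule
  assumes "X \<noteq> {}" and "compact X"
    and "is_norm N"
    and "L > 0"
    and "is_hierarchy X K H"
    and "cond_D1 N K H \<delta> R"
    and "cond_D2 N K H \<delta> \<nu>"
    and "valid_choice_rule sel" and "valid_choice_rule rsel"
  shows "certified_algorithm X N L (cDOO X L H \<delta> R sel rsel) \<and>
    (\<forall>f \<in> lip_class X N L. \<forall>\<epsilon> \<in> {0<..eps0 X N L}.
       ereal_of_enat (sample_complexity (cDOO X L H \<delta> R sel rsel) f \<epsilon>)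
       \<le> ereal (2 + real K * (of_bool (\<nu> / R \<ge> 1)
                              + of_bool (\<nu> / R < 1) * (4 * R / \<nu>) ^ CARD('d)))
         * ereal_of_enat (S_C X N L f \<epsilon>))"
proof -
  interpret doo X N L \<delta> R K H sel rsel
    using assms by unfold_locales
  show ?thesis
  proof (intro conjI ballI)
    show "certified_algorithm X N L (cDOO X L H \<delta> R sel rsel)" by (rule cDOO_certified)
  next
    fix f \<epsilon> assume f: "f \<in> lip_class X N L" and \<epsilon>: "\<epsilon> \<in> {0<..eps0 X N L}"
    then interpret doo_separated_run X N L \<delta> R K H sel rsel f \<nu>
      using assms by unfold_locales (simp_all add: lip_class_def L_lipschitz_def)
    have "packing_factor (\<nu> / R) DIM(real ^ 'd) =
        of_bool (\<nu> / R \<ge> 1) + of_bool (\<nu> / R < 1) * (4 * R / \<nu>) ^ CARD('d)"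
      by (simp add: packing_factor_def)
    then show "ereal_of_enat (sample_complexity (cDOO X L H \<delta> R sel rsel) f \<epsilon>)
       \<le> ereal (2 + real K * (of_bool (\<nu> / R \<ge> 1)
                              + of_bool (\<nu> / R < 1) * (4 * R / \<nu>) ^ CARD('d)))
         * ereal_of_enat (S_C X N L f \<epsilon>)"
      using cDOO_sample_complexity[of \<epsilon>] \<epsilon> by simp
  qed
qed

end
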